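(* Let $G$ be a finite Abelian group of order $v=p_1^{2k_1}p_2^{2k_2}\cdots p_n^{2k_n}$, where $n\ge 2$, $p_1,\dots,p_n$ are distinct odd primes and $k_1,\dots,k_n$ are positive integers. If there is a regular Paley type partial difference set in $G$, then for every $1\le i\le n$ with $k_i$ odd we have $p_i\equiv 3 \pmod 4$.
   Context: For a finite Abelian group $G$ of order $v$ with identity $e$, a subset $D\subseteq G$ of size $k$ is a $(v,k,\lambda,\mu)$-partial difference set (PDS) if the expressions $gh^{-1}$ with $g,h\in D$, $g\neq h$, represent each non-identity element of $D$ exactly $\lambda$ times and each non-identity element of $G\setminus D$ exactly $\mu$ times. It is regular if $D^{(-1)}=\{g^{-1}:g\in D\}=D$ and $e\notin D$. A Paley type PDS is a PDS with parameters $(v,(v-1)/2,(v-5)/4,(v-1)/4)$. *)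

theory Defs
  imports "HOL-Algebra.Coset" "HOL-Number_Theory.Cong" "HOL-Computational_Algebra.Primes"
begin

definition partial_difference_set ::
    "('a, 'b) monoid_scheme \<Rightarrow> nat \<Rightarrow> nat \<Rightarrow> nat \<Rightarrow> nat \<Rightarrow> 'a set \<Rightarrow> bool" where
  "partial_difference_set G v k l m D \<longleftrightarrow>
     comm_group G \<and> finite (carrier G) \<and> order G = v \<and>
     D \<subseteq> carrier G \<and> card D = k \<and>
     (\<forall>x \<in> D - {\<one>\<^bsub>G\<^esub>}.
        card {(g, h). g \<in> D \<and> h \<in> D \<and> g \<noteq> h \<and> g \<otimes>\<^bsub>G\<^esub> inv\<^bsub>G\<^esub> h = x} = l) \<and>
     (\<forall>x \<in> carrier G - D - {\<one>\<^bsub>G\<^esub>}.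
        card {(g, h). g \<in> D \<and> h \<in> D \<and> g \<noteq> h \<and> g \<otimes>\<^bsub>G\<^esub> inv\<^bsub>G\<^esub> h = x} = m)"

definition regular_subset :: "('a, 'b) monoid_scheme \<Rightarrow> 'a set \<Rightarrow> bool" where
  "regular_subset G D \<longleftrightarrow> (\<lambda>g. inv\<^bsub>G\<^esub> g) ` D = D \<and> \<one>\<^bsub>G\<^esub> \<notin> D"

text \<open>The parameters \<open>(v, (v - 1) / 2, (v - 5) / 4, (v - 1) / 4)\<close> are given by equations free of
  subtraction and division, to avoid truncation on natural numbers.\<close>

definition paley_type_pds :: "('a, 'b) monoid_scheme \<Rightarrow> 'a set \<Rightarrow> bool" where
  "paley_type_pds G D \<longleftrightarrow>
     (\<exists>v k l m. partial_difference_set G v k l m D \<and>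
        2 * k + 1 = v \<and> 4 * l + 5 = v \<and> 4 * m + 1 = v)"

end

theory Submission
  imports Defs "HOL-Algebra.Sylow" "HOL-Number_Theory.Residues"
begin

text \<open>Let \<open>f\<close> be the function that is \<open>1\<close> on \<open>D\<close>, \<open>0\<close> at the identity and \<open>-1\<close> elsewhere. The Paley
  parameters say that \<open>f * f = v e - G\<close> in the integral group ring, and no characters are needed:
  everything follows from the Frobenius congruence \<open>f\<^sup>q \<equiv> \<Sum> f(g) g\<^sup>q\<close> modulo a prime \<open>q\<close>.

  As \<open>v\<close> is a square, \<open>f\<^sup>q = v\<^bsup>(q - 1)/2\<^esup> f \<equiv> f\<close> for every odd prime \<open>q\<close> not dividing \<open>v\<close>, so \<open>f\<close> is
  invariant under \<open>x \<mapsto> x\<^sup>t\<close> for all \<open>t\<close> coprime to \<open>v\<close>.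

  Let \<open>P\<close> be the Sylow subgroup of order \<open>p\<^bsup>2k\<^esup>\<close> and \<open>F\<close> the push-forward of \<open>f\<close> to \<open>G/P\<close>. Then \<open>F * F\<close> is
  divisible by \<open>p\<^bsup>2k\<^esup>\<close>, hence \<open>F\<close> is divisible by \<open>p\<^sup>k\<close>. Since \<open>F\<close> is odd away from the identity, the value
  of \<open>\<Sum> F\<^sup>2\<close> forces \<open>F = \<plusminus>p\<^sup>k\<close> there.

  Finally take \<open>y \<notin> P\<close> of order prime to \<open>p\<close>. The set of \<open>x \<in> P - {e}\<close> with \<open>f(xy) = 1\<close> is closed under
  powers prime to \<open>p\<close>, so \<open>p - 1\<close> divides its size and \<open>F(Py) \<equiv> f(y)\<close> modulo \<open>2(p - 1)\<close>. For odd \<open>k\<close> we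
  have \<open>p\<^sup>k \<equiv> p\<close> modulo \<open>2(p - 1)\<close>, so \<open>\<plusminus>p \<equiv> \<plusminus>1\<close>, which is only possible for \<open>p = 3\<close>.\<close>

section \<open>Convolution on a finite group\<close>

definition point_mass :: "'a \<Rightarrow> 'r::zero \<Rightarrow> 'a \<Rightarrow> 'r" where
  "point_mass g a x = (if x = g then a else 0)"

locale finite_group = group +
  assumes finite_carrier [simp]: "finite (carrier G)"
begin

definition conv :: "('a \<Rightarrow> 'r::comm_semiring_1) \<Rightarrow> ('a \<Rightarrow> 'r) \<Rightarrow> 'a \<Rightarrow> 'r" where
  "conv f g z = (\<Sum>x\<in>carrier G. f x * g (inv x \<otimes> z))"

primrec conv_pow :: "('a \<Rightarrow> 'r::comm_semiring_1) \<Rightarrow> nat \<Rightarrow> 'a \<Rightarrow> 'r" where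
  "conv_pow f 0 = point_mass \<one> 1"
| "conv_pow f (Suc n) = conv f (conv_pow f n)"

lemma sum_left_translate:
  assumes "a \<in> carrier G"
  shows "(\<Sum>x\<in>carrier G. f (a \<otimes> x)) = (\<Sum>x\<in>carrier G. f x)"
  by (rule sum.reindex_bij_witness[where i = "\<lambda>x. inv a \<otimes> x" and j = "\<lambda>x. a \<otimes> x"])
     (use assms in \<open>auto simp: m_assoc[symmetric]\<close>)

lemma sum_reflect:
  assumes "z \<in> carrier G"
  shows "(\<Sum>x\<in>carrier G. f (inv x \<otimes> z)) = (\<Sum>x\<in>carrier G. f x)"
  by (rule sum.reindex_bij_witness[where i = "\<lambda>x. z \<otimes> inv x" and j = "\<lambda>x. inv x \<otimes> z"])
     (use assms in \<open>simp_all add: m_assoc[symmetric] inv_mult_group, simp add: m_assoc\<close>)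

lemma conv_cong:
  assumes "\<And>x. x \<in> carrier G \<Longrightarrow> f x = f' x" "\<And>x. x \<in> carrier G \<Longrightarrow> g x = g' x" "z \<in> carrier G"
  shows "conv f g z = conv f' g' z"
  unfolding conv_def by (rule sum.cong) (use assms in auto)

lemma conv_pow_cong:
  assumes "\<And>x. x \<in> carrier G \<Longrightarrow> f x = f' x" "z \<in> carrier G"
  shows "conv_pow f n z = conv_pow f' n z"
  using assms(2) by (induction n arbitrary: z) (auto intro!: conv_cong assms(1))

lemma conv_add_left: "conv (\<lambda>x. f x + g x) h z = conv f h z + conv g h z"
  by (simp add: conv_def distrib_right sum.distrib)

lemma conv_sum_right:
  "conv f (\<lambda>x. \<Sum>i\<in>I. c i * h i x) z = (\<Sum>i\<in>I. c i * conv f (h i) z)"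
proof -
  have "conv f (\<lambda>x. \<Sum>i\<in>I. c i * h i x) z
      = (\<Sum>x\<in>carrier G. \<Sum>i\<in>I. c i * (f x * h i (inv x \<otimes> z)))"
    by (simp add: conv_def sum_distrib_left mult.left_commute)
  also have "\<dots> = (\<Sum>i\<in>I. \<Sum>x\<in>carrier G. c i * (f x * h i (inv x \<otimes> z)))"
    by (rule sum.swap)
  finally show ?thesis by (simp add: conv_def sum_distrib_left)
qed

lemma conv_point_mass:
  assumes "g \<in> carrier G"
  shows "conv (point_mass g a) h z = a * h (inv g \<otimes> z)"
proof -
  have "conv (point_mass g a) h z = (\<Sum>x\<in>carrier G. if x = g then a * h (inv g \<otimes> z) else 0)"
    unfolding conv_def point_mass_def by (rule sum.cong) auto
  then show ?thesis using assms by simp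
qed

lemma conv_pow_point_mass:
  assumes "g \<in> carrier G" "z \<in> carrier G"
  shows "conv_pow (point_mass g a) n z = point_mass (g [^] n) (a ^ n) z"
  using assms(2)
proof (induction n arbitrary: z)
  case (Suc n)
  have "inv g \<otimes> z = g [^] n \<longleftrightarrow> z = g [^] Suc n"
    using assms(1) Suc.prems inv_solve_left'[of "g [^] n" g z] nat_pow_Suc2[of g n] by auto
  then show ?case
    using assms(1) Suc by (simp add: conv_point_mass) (simp add: point_mass_def)
qed simp

lemma conv_assoc:
  assumes "z \<in> carrier G"
  shows "conv (conv f g) h z = conv f (conv g h) z"
proof -
  have shift: "(\<Sum>y\<in>carrier G. g (inv x \<otimes> y) * h (inv y \<otimes> z)) = conv g h (inv x \<otimes> z)"
    if x: "x \<in> carrier G" for x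
  proof -
    have "(\<Sum>y\<in>carrier G. g (inv x \<otimes> y) * h (inv y \<otimes> z))
        = (\<Sum>y\<in>carrier G. g (inv x \<otimes> (x \<otimes> y)) * h (inv (x \<otimes> y) \<otimes> z))"
      by (rule sum_left_translate[symmetric, OF x])
    also have "\<dots> = (\<Sum>y\<in>carrier G. g y * h (inv y \<otimes> (inv x \<otimes> z)))"
      using x assms by (intro sum.cong) (simp_all add: m_assoc[symmetric] inv_mult_group)
    finally show ?thesis by (simp add: conv_def)
  qed
  have "conv (conv f g) h z
      = (\<Sum>y\<in>carrier G. \<Sum>x\<in>carrier G. f x * (g (inv x \<otimes> y) * h (inv y \<otimes> z)))"
    by (simp add: conv_def sum_distrib_right mult.assoc)
  also have "\<dots> = (\<Sum>x\<in>carrier G. \<Sum>y\<in>carrier G. f x * (g (inv x \<otimes> y) * h (inv y \<otimes> z)))"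
    by (rule sum.swap)
  also have "\<dots> = (\<Sum>x\<in>carrier G. f x * conv g h (inv x \<otimes> z))"
    by (simp add: sum_distrib_left[symmetric] shift)
  finally show ?thesis by (simp add: conv_def[of f])
qed

lemma sum_conv:
  "(\<Sum>z\<in>carrier G. conv f g z) = (\<Sum>x\<in>carrier G. f x) * (\<Sum>x\<in>carrier G. g x)"
proof -
  have "(\<Sum>z\<in>carrier G. conv f g z) = (\<Sum>x\<in>carrier G. \<Sum>z\<in>carrier G. f x * g (inv x \<otimes> z))"
    unfolding conv_def by (rule sum.swap)
  also have "\<dots> = (\<Sum>x\<in>carrier G. f x * (\<Sum>z\<in>carrier G. g z))"
    by (simp add: sum_distrib_left[symmetric] sum_left_translate)
  finally show ?thesis by (simp add: sum_distrib_right)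
qed

definition pushforward :: "('a \<Rightarrow> 'c) \<Rightarrow> ('a \<Rightarrow> 'r::comm_semiring_1) \<Rightarrow> 'c \<Rightarrow> 'r" where
  "pushforward \<phi> f y = (\<Sum>x | x \<in> carrier G \<and> \<phi> x = y. f x)"

lemma sum_pushforward:
  assumes "finite T" "\<phi> ` carrier G \<subseteq> T"
  shows "(\<Sum>y\<in>T. pushforward \<phi> f y * h y) = (\<Sum>x\<in>carrier G. f x * h (\<phi> x))"
proof -
  have "(\<Sum>y\<in>T. pushforward \<phi> f y * h y)
      = (\<Sum>y\<in>T. \<Sum>x | x \<in> carrier G \<and> \<phi> x = y. f x * h (\<phi> x))"
    unfolding pushforward_def by (auto simp: sum_distrib_right intro!: sum.cong)
  also have "\<dots> = (\<Sum>x\<in>carrier G. f x * h (\<phi> x))"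
    by (rule sum.group) (use assms in auto)
  finally show ?thesis .
qed

lemma conv_pushforward:
  assumes "finite_group H" and hom: "\<phi> \<in> hom G H" and w: "w \<in> carrier H"
  shows "finite_group.conv H (pushforward \<phi> f) (pushforward \<phi> g) w = pushforward \<phi> (conv f g) w"
proof -
  interpret H: finite_group H by fact
  interpret group_hom G H \<phi>
    by (intro group_hom.intro group_hom_axioms.intro hom is_group H.is_group)
  have shift: "pushforward \<phi> g (inv\<^bsub>H\<^esub> \<phi> x \<otimes>\<^bsub>H\<^esub> w)
      = (\<Sum>z | z \<in> carrier G \<and> \<phi> z = w. g (inv x \<otimes> z))" if x: "x \<in> carrier G" for x
    unfolding pushforward_def
    by (rule sum.reindex_bij_witness[where i = "\<lambda>z. inv x \<otimes> z" and j = "\<lambda>z. x \<otimes> z"])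
       (use x w in \<open>auto simp: m_assoc[symmetric] H.m_assoc[symmetric]\<close>)
  have "H.conv (pushforward \<phi> f) (pushforward \<phi> g) w
      = (\<Sum>x\<in>carrier G. f x * pushforward \<phi> g (inv\<^bsub>H\<^esub> \<phi> x \<otimes>\<^bsub>H\<^esub> w))"
    unfolding H.conv_def by (rule sum_pushforward) auto
  also have "\<dots> = (\<Sum>x\<in>carrier G. \<Sum>z | z \<in> carrier G \<and> \<phi> z = w. f x * g (inv x \<otimes> z))"
    by (simp add: shift sum_distrib_left)
  also have "\<dots> = (\<Sum>z | z \<in> carrier G \<and> \<phi> z = w. \<Sum>x\<in>carrier G. f x * g (inv x \<otimes> z))"
    by (rule sum.swap)
  finally show ?thesis by (simp add: pushforward_def[of \<phi> "conv f g"] conv_def)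
qed

end

section \<open>The Frobenius congruence\<close>

lemma sum_binomial_Suc:
  fixes b :: "nat \<Rightarrow> nat \<Rightarrow> 'r::comm_semiring_1"
  shows "(\<Sum>k\<le>n. of_nat (n choose k) * (b (Suc k) (n - k) + b k (Suc (n - k))))
       = (\<Sum>k\<le>Suc n. of_nat (Suc n choose k) * b k (Suc n - k))"
proof -
  have "(\<Sum>k\<le>Suc n. of_nat (Suc n choose k) * b k (Suc n - k))
      = (\<Sum>k\<le>n. of_nat (n choose k) * b (Suc k) (n - k))
        + (b 0 (Suc n) + (\<Sum>k\<le>n. of_nat (n choose Suc k) * b (Suc k) (n - k)))"
    by (subst sum.atMost_Suc_shift) (simp add: algebra_simps sum.distrib)
  also have "b 0 (Suc n) + (\<Sum>k\<le>n. of_nat (n choose Suc k) * b (Suc k) (n - k))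
      = (\<Sum>k\<le>Suc n. of_nat (n choose k) * b k (Suc n - k))"
    by (subst sum.atMost_Suc_shift) simp
  also have "\<dots> = (\<Sum>k\<le>n. of_nat (n choose k) * b k (Suc (n - k)))"
    by (simp add: Suc_diff_le binomial_eq_0)
  finally show ?thesis by (simp add: algebra_simps sum.distrib)
qed

lemma prime_power_cong_self:
  fixes a :: int
  assumes "prime q"
  shows "[a ^ q = a] (mod int q)"
proof -
  define r where "r = nat (a mod int q)"
  have r: "[a = int r] (mod int q)"
    using prime_gt_0_nat[OF assms] by (simp add: r_def cong_def)
  have "[r ^ q = r] (mod q)"
  proof (cases "q dvd r")
    case True
    then show ?thesis
      using prime_gt_0_nat[OF assms] by (simp add: cong_def mod_eq_0_iff_dvd dvd_trans[OF _ dvd_power])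
  next
    case False
    then have "[r * r ^ (q - 1) = r * 1] (mod q)"
      using fermat_theorem assms by (intro cong_scalar_left) blast
    then show ?thesis
      using prime_gt_0_nat[OF assms] by (simp add: power_eq_if)
  qed
  then have "[int r ^ q = int r] (mod int q)" by (metis cong_int_iff of_nat_power)
  then show ?thesis using r by (meson cong_pow cong_sym cong_trans)
qed

lemma (in group) eq_one_of_coprime_pow:
  fixes a b :: nat
  assumes "x \<in> carrier G" "coprime a b" "x [^] a = \<one>" "x [^] b = \<one>"
  shows "x = \<one>"
proof -
  have "ord x dvd a" "ord x dvd b" using assms pow_eq_id by simp_all
  then have "ord x = 1" using assms(2) by (metis coprime_common_divisor_nat)
  then show ?thesis using assms(1) ord_eq_1 by simp
qed

locale finite_comm_group = finite_group + comm_group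
begin

lemma conv_commute:
  assumes "z \<in> carrier G"
  shows "conv f g z = conv g f z"
  unfolding conv_def
  by (rule sum.reindex_bij_witness[where i = "\<lambda>x. inv x \<otimes> z" and j = "\<lambda>x. inv x \<otimes> z"])
     (use assms in \<open>auto simp: inv_mult m_assoc m_lcomm mult.commute\<close>)

lemma conv_left_commute:
  assumes "z \<in> carrier G"
  shows "conv f (conv g h) z = conv g (conv f h) z"
proof -
  have "conv (conv f g) h z = conv (conv g f) h z"
    by (rule conv_cong) (use assms conv_commute in auto)
  then show ?thesis using assms by (simp add: conv_assoc)
qed

lemma conv_one_right: "z \<in> carrier G \<Longrightarrow> conv f (point_mass \<one> 1) z = f z"
  by (simp add: conv_commute[of z f] conv_point_mass)

lemma conv_pow_add:
  assumes "z \<in> carrier G"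
  shows "conv_pow (\<lambda>x. f x + g x) n z
    = (\<Sum>k\<le>n. of_nat (n choose k) * conv (conv_pow f k) (conv_pow g (n - k)) z)"
  using assms
proof (induction n arbitrary: z)
  case 0
  then show ?case by (simp add: conv_point_mass)
next
  case (Suc n)
  let ?b = "\<lambda>i j. conv (conv_pow f i) (conv_pow g j)"
  let ?p = "\<lambda>x. \<Sum>k\<le>n. of_nat (n choose k) * ?b k (n - k) x"
  have "conv_pow (\<lambda>x. f x + g x) (Suc n) z = conv (\<lambda>x. f x + g x) ?p z"
    using Suc by (auto intro: conv_cong)
  also have "\<dots> = (\<Sum>k\<le>n. of_nat (n choose k) * (conv f (?b k (n - k)) z + conv g (?b k (n - k)) z))"
    by (simp add: conv_add_left conv_sum_right distrib_left sum.distrib)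
  also have "\<dots> = (\<Sum>k\<le>n. of_nat (n choose k) * (?b (Suc k) (n - k) z + ?b k (Suc (n - k)) z))"
    using Suc.prems conv_left_commute[of z g] by (simp add: conv_assoc)
  also have "\<dots> = (\<Sum>k\<le>Suc n. of_nat (Suc n choose k) * ?b k (Suc n - k) z)"
    by (rule sum_binomial_Suc)
  finally show ?case .
qed

lemma conv_pow_prime_add_cong:
  fixes f g :: "'a \<Rightarrow> int"
  assumes q: "prime q" and z: "z \<in> carrier G"
  shows "[conv_pow (\<lambda>x. f x + g x) q z = conv_pow f q z + conv_pow g q z] (mod int q)"
proof -
  let ?t = "\<lambda>k. int (q choose k) * conv (conv_pow f k) (conv_pow g (q - k)) z"
  have q0: "q > 0" using q prime_gt_0_nat by blast
  then have ends: "{..q} = insert 0 (insert q {0<..<q})" by auto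
  have "conv_pow (\<lambda>x. f x + g x) q z = conv_pow f q z + conv_pow g q z + (\<Sum>k\<in>{0<..<q}. ?t k)"
    using q0 z by (simp add: conv_pow_add ends conv_one_right conv_point_mass)
  moreover have "int q dvd (\<Sum>k\<in>{0<..<q}. ?t k)"
    using q by (intro dvd_sum dvd_mult2) (auto intro: dvd_choose_prime)
  ultimately show ?thesis by (simp add: cong_iff_dvd_diff)
qed

lemma conv_pow_prime_cong:
  fixes f :: "'a \<Rightarrow> int"
  assumes q: "prime q" and z: "z \<in> carrier G"
  shows "[conv_pow f q z = (\<Sum>g\<in>carrier G. point_mass (g [^] q) (f g) z)] (mod int q)"
proof -
  have "[conv_pow (\<lambda>x. if x \<in> S then f x else 0) q z
      = (\<Sum>g\<in>S. point_mass (g [^] q) (f g) z)] (mod int q)"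
    if "finite S" "S \<subseteq> carrier G" for S
    using that
  proof (induction S rule: finite_induct)
    case empty
    then show ?case using prime_gt_0_nat[OF q] by (cases q) (auto simp: conv_def)
  next
    case (insert g S)
    let ?h = "\<lambda>x. if x \<in> S then f x else 0"
    have "(\<lambda>x. if x \<in> insert g S then f x else 0) = (\<lambda>x. point_mass g (f g) x + ?h x)"
      using insert.hyps by (auto simp: point_mass_def)
    then have "[conv_pow (\<lambda>x. if x \<in> insert g S then f x else 0) q z
        = conv_pow (point_mass g (f g)) q z + conv_pow ?h q z] (mod int q)"
      using conv_pow_prime_add_cong[OF q z] by simp
    moreover have "[conv_pow (point_mass g (f g)) q z = point_mass (g [^] q) (f g) z] (mod int q)"
      using prime_power_cong_self[OF q] insert.prems z
      by (simp add: conv_pow_point_mass) (simp add: point_mass_def)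
    moreover have "[conv_pow ?h q z = (\<Sum>g\<in>S. point_mass (g [^] q) (f g) z)] (mod int q)"
      using insert by simp
    ultimately show ?case
      using insert.hyps by (simp add: cong_add cong_trans[OF _ cong_add])
  qed
  from this[of "carrier G"] show ?thesis
    using conv_pow_cong[of "\<lambda>x. if x \<in> carrier G then f x else 0" f z q] z by simp
qed

lemma pow_coprime_order_eq_iff:
  assumes "coprime n (order G)" "x \<in> carrier G" "y \<in> carrier G"
  shows "x [^] n = y [^] n \<longleftrightarrow> x = y"
proof
  assume "x [^] n = y [^] n"
  then have "(x \<otimes> inv y) [^] n = \<one>"
    using assms by (simp add: pow_mult_distrib m_comm nat_pow_inv)
  moreover have "(x \<otimes> inv y) [^] order G = \<one>" using assms pow_order_eq_1 by simp
  ultimately have "x \<otimes> inv y = \<one>" using assms eq_one_of_coprime_pow by simp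
  then show "x = y" using assms by (metis inv_equality inv_inv inv_closed)
qed simp

lemma conv_pow_prime_cong_coprime:
  fixes f :: "'a \<Rightarrow> int"
  assumes "prime q" "coprime q (order G)" "x \<in> carrier G"
  shows "[conv_pow f q (x [^] q) = f x] (mod int q)"
proof -
  have "(\<Sum>g\<in>carrier G. point_mass (g [^] q) (f g) (x [^] q))
      = (\<Sum>g\<in>carrier G. if g = x then f g else 0)"
    using assms pow_coprime_order_eq_iff[of q x]
    by (intro sum.cong) (auto simp: point_mass_def)
  then show ?thesis
    using conv_pow_prime_cong[OF assms(1), of "x [^] q" f] assms by simp
qed

text \<open>The group ring of \<open>G\<close> over the field with \<open>q\<close> elements is reduced if \<open>q\<close> does not divide the
  order of \<open>G\<close>, since \<open>F\<^sup>q\<close> determines \<open>F\<close> by the Frobenius congruence.\<close>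

lemma prime_dvd_of_dvd_conv:
  fixes F :: "'a \<Rightarrow> int"
  assumes q: "prime q" "coprime q (order G)"
    and dvd: "\<And>z. z \<in> carrier G \<Longrightarrow> int q dvd conv F F z" and x: "x \<in> carrier G"
  shows "int q dvd F x"
proof -
  obtain n where n: "q = Suc (Suc n)" using q by (metis prime_ge_2_nat add_2_eq_Suc le_Suc_ex)
  have "conv_pow F q (x [^] q) = conv (conv F F) (conv_pow F n) (x [^] q)"
    using x by (simp add: n conv_assoc del: nat_pow_Suc)
  then have "int q dvd conv_pow F q (x [^] q)"
    unfolding conv_def[of "conv F F"] by (auto intro!: dvd_sum dvd_mult2 dvd)
  then show ?thesis
    using conv_pow_prime_cong_coprime[OF q x, of F] by (simp add: cong_dvd_iff)
qed

lemma dvd_of_power2_dvd_conv: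
  fixes F :: "'a \<Rightarrow> int"
  assumes "n > 0" "coprime n (order G)"
    and "\<And>z. z \<in> carrier G \<Longrightarrow> (int n)\<^sup>2 dvd conv F F z" and "x \<in> carrier G"
  shows "int n dvd F x"
  using assms
proof (induction n arbitrary: F x rule: prime_divisors_induct)
  case (factor q n)
  have "int q dvd F x" if "x \<in> carrier G" for x
  proof (rule prime_dvd_of_dvd_conv[OF factor.hyps _ _ that])
    show "int q dvd conv F F z" if "z \<in> carrier G" for z
      using factor.prems(3)[OF that] by (auto simp: power2_eq_square intro: dvd_mult_left)
  qed (use factor.prems in auto)
  then obtain F' where F: "F x = int q * F' x" if "x \<in> carrier G" for x
    unfolding dvd_def by metis
  have "int n dvd F' x"
  proof (rule factor.IH)
    fix z assume z: "z \<in> carrier G"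
    have "conv F F z = (int q)\<^sup>2 * conv F' F' z"
      unfolding conv_def
      by (auto simp: sum_distrib_left F z power2_eq_square intro!: sum.cong)
    then show "(int n)\<^sup>2 dvd conv F' F' z"
      using factor.prems(3)[OF z] prime_gt_0_nat[OF factor.hyps] by (simp add: power_mult_distrib)
  qed (use factor.prems in auto)
  then show ?case using F factor.prems(4) by simp
qed auto

end

section \<open>Sets closed under coprime powers\<close>

lemma (in group) pow_eq_of_cong:
  fixes a b n :: nat
  assumes "x \<in> carrier G" "x [^] n = \<one>" "[a = b] (mod n)"
  shows "x [^] a = x [^] b"
proof -
  have "ord x dvd n" using assms pow_eq_id by simp
  then have "[a = b] (mod ord x)" using assms(3) cong_dvd_modulus_nat by blast
  then have "int (ord x) dvd int b - int a" by (metis cong_iff_dvd_diff cong_int_iff cong_sym)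
  then have "x [^] int a = x [^] int b" using assms(1) int_pow_eq by blast
  then show ?thesis by (simp only: int_pow_int)
qed

lemma (in group) subgroup_pow_card:
  assumes "subgroup P G" "x \<in> P"
  shows "x [^] card P = \<one>"
proof -
  interpret P: group "G\<lparr>carrier := P\<rparr>" using assms(1) subgroup_imp_group by blast
  show ?thesis
    using P.pow_order_eq_1[of x] assms(2) by (simp add: order_def nat_pow_consistent[symmetric])
qed

context finite_group
begin

lemma generate_coprime_pow:
  fixes t :: nat
  assumes x: "x \<in> carrier G" and t: "coprime t (ord x)"
  shows "generate G {x [^] t} = generate G {x}"
proof (rule card_subset_eq)
  have "generate G {x} \<subseteq> carrier G" using x by (simp add: generate_incl)
  then show "finite (generate G {x})" by (rule finite_subset) simp
  have "x [^] t \<in> generate G {x}"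
    using x by (auto simp: generate_pow_on_finite_carrier)
  then show "generate G {x [^] t} \<subseteq> generate G {x}"
    using generate_subgroup_incl[OF _ generate_is_subgroup] x by simp
  show "card (generate G {x [^] t}) = card (generate G {x})"
    using x t pow_ord_eq_ord_iff by (simp add: generate_pow_card[symmetric])
qed

lemma generators_eq_image_totatives:
  assumes x: "x \<in> carrier G"
  shows "{y \<in> carrier G. generate G {y} = generate G {x}} = (\<lambda>t. x [^] t) ` totatives (ord x)"
proof (intro equalityI subsetI)
  fix y assume "y \<in> {y \<in> carrier G. generate G {y} = generate G {x}}"
  then have y: "y \<in> carrier G" "generate G {y} = generate G {x}" by auto
  then have "y \<in> generate G {x}" using generate.incl[of y "{y}" G] by simp
  then obtain i where i: "i \<le> ord x - 1" "y = x [^] i"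
    using x ord_elems[OF _ x] by (auto simp: generate_pow_on_finite_carrier)
  have "ord (x [^] i) = ord x" using x y i by (simp add: generate_pow_card)
  then have cop: "coprime i (ord x)" using x pow_ord_eq_ord_iff by simp
  show "y \<in> (\<lambda>t. x [^] t) ` totatives (ord x)"
  proof (cases "i = 0")
    case True
    then have "ord x = 1" using cop by simp
    moreover have "x = \<one>" using calculation x ord_eq_1 by simp
    ultimately show ?thesis using i True by auto
  next
    case False
    then show ?thesis using i cop by (auto simp: in_totatives_iff)
  qed
next
  fix y assume "y \<in> (\<lambda>t. x [^] t) ` totatives (ord x)"
  then show "y \<in> {y \<in> carrier G. generate G {y} = generate G {x}}"
    using x generate_coprime_pow by (auto simp: in_totatives_iff)
qed

lemma card_generators:
  assumes "x \<in> carrier G"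
  shows "card {y \<in> carrier G. generate G {y} = generate G {x}} = totient (ord x)"
proof -
  have "inj_on (\<lambda>t. x [^] t) (totatives (ord x))"
    by (rule inj_on_subset[OF ord_inj'[OF assms]]) (auto simp: in_totatives_iff)
  then show ?thesis
    using assms by (simp add: generators_eq_image_totatives card_image totient_def)
qed

lemma dvd_card_of_coprime_pow_closed:
  assumes A: "A \<subseteq> carrier G"
    and dvd: "\<And>x. x \<in> A \<Longrightarrow> m dvd totient (ord x)"
    and closed: "\<And>x t. x \<in> A \<Longrightarrow> coprime t (ord x) \<Longrightarrow> x [^] (t::nat) \<in> A"
  shows "m dvd card A"
proof -
  define C where "C x = {y \<in> carrier G. generate G {y} = generate G {x}}" for x
  have "C x \<subseteq> A" if x: "x \<in> A" for x
    unfolding C_def generators_eq_image_totatives[OF subsetD[OF A x]]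
    using closed[OF x] by (auto simp: in_totatives_iff)
  moreover have "x \<in> C x" if "x \<in> A" for x using that A by (auto simp: C_def)
  ultimately have "A = \<Union>(C ` A)" by blast
  moreover have "m dvd card (\<Union>(C ` A))"
  proof (rule dvd_partition)
    show "finite (\<Union>(C ` A))" using finite_subset[OF A] calculation by simp
    show "\<forall>c\<in>C ` A. m dvd card c" using A dvd by (auto simp: C_def card_generators)
    show "\<forall>c1\<in>C ` A. \<forall>c2\<in>C ` A. c1 \<noteq> c2 \<longrightarrow> c1 \<inter> c2 = {}" by (auto simp: C_def)
  qed
  ultimately show ?thesis by simp
qed

lemma prime_minus_one_dvd_card:
  assumes p: "prime p" and A: "A \<subseteq> carrier G - {\<one>}"
    and torsion: "\<And>x. x \<in> A \<Longrightarrow> x [^] (p ^ j) = \<one>"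
    and closed: "\<And>x t. x \<in> A \<Longrightarrow> coprime t p \<Longrightarrow> x [^] (t::nat) \<in> A"
  shows "(p - 1) dvd card A"
proof (rule dvd_card_of_coprime_pow_closed)
  have ord: "\<exists>i>0. ord x = p ^ i" if x: "x \<in> A" for x
  proof -
    have xG: "x \<in> carrier G" "x \<noteq> \<one>" using x A by auto
    then have "ord x dvd p ^ j" using torsion[OF x] pow_eq_id by simp
    then obtain i where i: "ord x = p ^ i" using divides_primepow_nat[OF p] by blast
    then have "i > 0" using xG ord_eq_1[of x] by (cases i) auto
    then show ?thesis using i by blast
  qed
  show "(p - 1) dvd totient (ord x)" if "x \<in> A" for x
    using ord[OF that] p by (auto simp: totient_prime_power)
  show "x [^] (t::nat) \<in> A" if "x \<in> A" "coprime t (ord x)" for x t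
    using ord[OF that(1)] that closed by auto
qed (use A in auto)

lemma exists_nontrivial_torsion:
  assumes "M dvd order G" "M > 1"
  obtains y where "y \<in> carrier G" "y \<noteq> \<one>" "y [^] M = \<one>"
proof -
  obtain q where q: "prime q" "q dvd M" using assms(2) prime_factor_nat[of M] by auto
  then obtain m where "order G = q * m" using dvd_trans[OF q(2) assms(1)] by (auto elim: dvdE)
  then obtain Q where Q: "subgroup Q G" "card Q = q"
    using sylow_thm[OF q(1) is_group, of 1 m] by auto
  have "Q \<noteq> {\<one>}" using Q(2) q(1) by auto
  then obtain y where y: "y \<in> Q" "y \<noteq> \<one>" using subgroup.one_closed[OF Q(1)] by blast
  have yG: "y \<in> carrier G" by (rule subgroup.mem_carrier[OF Q(1) y(1)])
  have "y [^] q = \<one>" using subgroup_pow_card[OF Q(1) y(1)] Q(2) by simp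
  then have "y [^] M = \<one>" using dvd_trans[of "ord y" q M] q(2) yG by (simp add: pow_eq_id)
  then show thesis using that yG y(2) by blast
qed

end

section \<open>Coset sums\<close>

lemma (in group) r_coset_eq_subgroup_iff:
  "subgroup P G \<Longrightarrow> a \<in> carrier G \<Longrightarrow> P #> a = P \<longleftrightarrow> a \<in> P"
  using coset_join1 coset_join2 by blast

lemma (in group) mult_notin_subgroup_neq_one:
  assumes "subgroup P G" "x \<in> P" "y \<in> carrier G - P"
  shows "x \<otimes> y \<in> carrier G - {\<one>}"
proof -
  have x: "x \<in> carrier G" by (rule subgroup.mem_carrier[OF assms(1,2)])
  have "x \<otimes> y \<noteq> \<one>"
  proof
    assume "x \<otimes> y = \<one>"
    then have "y = inv x" using x assms(3) inv_equality[of y x] inv_comm by auto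
    then show False using subgroup.m_inv_closed[OF assms(1,2)] assms(3) by simp
  qed
  then show ?thesis using x assms(3) by simp
qed

lemma (in group) order_FactGroup:
  "subgroup P G \<Longrightarrow> order (G Mod P) * card P = order G"
  using lagrange by (simp add: order_def FactGroup_def)

lemma abs_eq_1_of_sum_power2_le_card:
  fixes c :: "'a \<Rightarrow> int"
  assumes "finite A" "\<And>x. x \<in> A \<Longrightarrow> c x \<noteq> 0" "(\<Sum>x\<in>A. (c x)\<^sup>2) \<le> int (card A)" "a \<in> A"
  shows "\<bar>c a\<bar> = 1"
proof -
  have ge: "(c x)\<^sup>2 - 1 \<ge> 0" if "x \<in> A" for x
    using assms(2)[OF that] zero_less_power2[of "c x"] by linarith
  have "(c a)\<^sup>2 - 1 \<le> (\<Sum>x\<in>A. (c x)\<^sup>2 - 1)"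
    using assms ge by (intro member_le_sum) auto
  also have "\<dots> \<le> 0" using assms(3) by (simp add: sum_subtractf)
  finally have "(c a)\<^sup>2 = 1" using ge[OF assms(4)] by linarith
  then show ?thesis by (auto simp: power2_eq_1_iff)
qed

context finite_comm_group
begin

lemma finite_comm_group_FactGroup:
  assumes "subgroup P G"
  shows "finite_comm_group (G Mod P)"
proof -
  interpret H: comm_group "G Mod P" by (rule abelian_FactGroup[OF assms])
  show ?thesis by unfold_locales (simp add: carrier_FactGroup)
qed

lemma pushforward_r_coset:
  assumes P: "subgroup P G" and a: "a \<in> carrier G"
  shows "pushforward (\<lambda>x. P #> x) f (P #> a) = (\<Sum>x\<in>P. f (x \<otimes> a))"
proof -
  have sub: "P \<subseteq> carrier G" using P subgroup.subset by blast
  have "{x. x \<in> carrier G \<and> P #> x = P #> a} = P #> a"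
    using a P sub repr_independence[of _ P a] rcos_self r_coset_subset_G by blast
  then have "{x. x \<in> carrier G \<and> P #> x = P #> a} = (\<lambda>x. x \<otimes> a) ` P"
    by (auto simp: r_coset_def)
  then show ?thesis
    using inj_on_g[OF sub a] by (simp add: pushforward_def sum.reindex)
qed

text \<open>The hypothesis on \<open>F\<close> says \<open>F * F = n\<^sup>2 (v e - G)\<close> in the group ring. By reducedness \<open>F = n c\<close> for
  an integral \<open>c\<close>, and \<open>\<Sum> c\<^sup>2 = v - 1\<close> leaves no room for values of \<open>c\<close> other than \<open>\<plusminus>1\<close>.\<close>

lemma abs_eq_of_conv_self:
  fixes F :: "'a \<Rightarrow> int"
  assumes n: "n > 0" "coprime n (order G)"
    and conv: "\<And>z. z \<in> carrier G \<Longrightarrow>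
      conv F F z = (int n)\<^sup>2 * ((if z = \<one> then int (order G) else 0) - 1)"
    and F_inv: "\<And>x. x \<in> carrier G \<Longrightarrow> F (inv x) = F x"
    and nonzero: "\<And>x. x \<in> carrier G - {\<one>} \<Longrightarrow> F x \<noteq> 0"
    and x: "x \<in> carrier G" "x \<noteq> \<one>"
  shows "\<bar>F x\<bar> = int n"
proof -
  have "int n dvd F x" if "x \<in> carrier G" for x
    by (rule dvd_of_power2_dvd_conv[OF n _ that]) (simp add: conv)
  then obtain c where F: "F x = int n * c x" if "x \<in> carrier G" for x
    unfolding dvd_def by metis
  have "(int n)\<^sup>2 * (\<Sum>x\<in>carrier G. (c x)\<^sup>2) = conv F F \<one>"
    unfolding conv_def sum_distrib_left
    by (rule sum.cong) (simp_all add: F_inv flip: power_mult_distrib F power2_eq_square)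
  then have sum_c: "(\<Sum>x\<in>carrier G. (c x)\<^sup>2) = int (order G) - 1" using n(1) by (simp add: conv)
  have "(\<Sum>x\<in>carrier G - {\<one>}. (c x)\<^sup>2) \<le> (\<Sum>x\<in>carrier G. (c x)\<^sup>2)"
    by (rule sum_mono2) auto
  also have "\<dots> = int (card (carrier G - {\<one>}))"
    using sum_c card_Suc_Diff1[of "carrier G" \<one>] by (simp add: order_def)
  finally have "\<bar>c x\<bar> = 1"
    using nonzero F x by (intro abs_eq_1_of_sum_power2_le_card[of "carrier G - {\<one>}"]) auto
  then show ?thesis using F[OF x(1)] by (simp add: abs_mult)
qed

end

section \<open>Paley functions\<close>

text \<open>The function \<open>f\<close> stands for the group ring element \<open>2 D - G + e\<close>.\<close>

locale paley_function = finite_comm_group +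
  fixes f :: "'a \<Rightarrow> int"
  assumes f_one: "f \<one> = 0"
    and f_sign: "\<And>x. x \<in> carrier G - {\<one>} \<Longrightarrow> f x = 1 \<or> f x = - 1"
    and f_inv: "\<And>x. x \<in> carrier G \<Longrightarrow> f (inv x) = f x"
    and conv_f_f: "\<And>z. z \<in> carrier G \<Longrightarrow> conv f f z = (if z = \<one> then int (order G) else 0) - 1"
begin

lemma sum_f: "(\<Sum>x\<in>carrier G. f x) = 0"
proof -
  have "(\<Sum>x\<in>carrier G. f x) * (\<Sum>x\<in>carrier G. f x) = (\<Sum>z\<in>carrier G. conv f f z)"
    by (rule sum_conv[symmetric])
  also have "\<dots> = 0" by (simp add: conv_f_f sum_subtractf order_def)
  finally show ?thesis by simp
qed

lemma odd_f: "x \<in> carrier G - {\<one>} \<Longrightarrow> odd (f x)"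
  using f_sign[of x] by auto

lemma abs_f_le_1: "x \<in> carrier G \<Longrightarrow> \<bar>f x\<bar> \<le> 1"
  using f_sign[of x] f_one by (cases "x = \<one>") auto

lemma odd_order: "odd (order G)"
proof -
  have "{x \<in> carrier G. odd (f x)} = carrier G - {\<one>}" using odd_f f_one by auto
  then have "even (card (carrier G - {\<one>}))"
    using even_sum_iff[OF finite_carrier, of f] sum_f by simp
  moreover have "order G = Suc (card (carrier G - {\<one>}))"
    by (simp only: order_def card_Suc_Diff1[OF finite_carrier one_closed])
  ultimately show ?thesis by simp
qed

lemma conv_f_conv_f:
  assumes "z \<in> carrier G"
  shows "conv f (conv f h) z = int (order G) * h z - (\<Sum>x\<in>carrier G. h x)"
proof -
  have "conv f (conv f h) z = conv (conv f f) h z" using assms by (simp add: conv_assoc)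
  also have "\<dots> = (\<Sum>x\<in>carrier G. (if x = \<one> then int (order G) * h z else 0) - h (inv x \<otimes> z))"
    unfolding conv_def[of "conv f f"]
    using assms by (intro sum.cong) (auto simp: conv_f_f algebra_simps)
  also have "\<dots> = int (order G) * h z - (\<Sum>x\<in>carrier G. h x)"
    using assms by (simp add: sum_subtractf sum_reflect)
  finally show ?thesis .
qed

lemma conv_pow_f_odd:
  assumes "z \<in> carrier G"
  shows "conv_pow f (2 * j + 1) z = int (order G) ^ j * f z"
  using assms
proof (induction j arbitrary: z)
  case 0
  then show ?case by (simp add: conv_one_right)
next
  case (Suc j)
  have "conv_pow f (2 * Suc j + 1) z
      = int (order G) * conv_pow f (2 * j + 1) z - (\<Sum>x\<in>carrier G. conv_pow f (2 * j + 1) x)"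
    using conv_f_conv_f[OF Suc.prems, of "conv_pow f (2 * j + 1)"] by simp
  also have "\<dots> = int (order G) ^ Suc j * f z - int (order G) ^ j * (\<Sum>x\<in>carrier G. f x)"
    unfolding sum_distrib_left using Suc by (simp del: conv_pow.simps)
  finally show ?case by (simp add: sum_f)
qed

lemma f_pow_odd_prime:
  assumes square: "order G = m\<^sup>2" and q: "prime q" "odd q" "coprime q (order G)"
    and x: "x \<in> carrier G"
  shows "f (x [^] q) = f x"
proof -
  obtain j where j: "q = 2 * j + 1" using q(2) by (auto elim: oddE)
  have "\<not> q dvd m" using q square by (auto simp: coprime_absorb_left)
  then have "[m ^ (q - 1) = 1] (mod q)" using fermat_theorem q by blast
  then have "[order G ^ j = 1] (mod q)" using j square by (simp add: power_mult)
  then have "[int (order G) ^ j = 1] (mod int q)" by (metis cong_int_iff of_nat_1 of_nat_power)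
  then have "[int (order G) ^ j * f (x [^] q) = 1 * f (x [^] q)] (mod int q)"
    by (rule cong_scalar_right)
  moreover have "[int (order G) ^ j * f (x [^] q) = f x] (mod int q)"
    using conv_pow_prime_cong_coprime[OF q(1,3) x, of f] conv_pow_f_odd[of "x [^] q" j] x j by simp
  ultimately have "[f (x [^] q) = f x] (mod int q)" by (metis cong_sym cong_trans mult_1)
  then have dvd: "int q dvd f (x [^] q) - f x" by (simp add: cong_iff_dvd_diff)
  have "q \<ge> 3" using q prime_ge_2_nat[of q] by (cases "q = 2") auto
  moreover have "\<bar>f (x [^] q) - f x\<bar> \<le> 2"
    using abs_f_le_1[of x] abs_f_le_1[of "x [^] q"] x by auto
  ultimately show ?thesis using dvd zdvd_imp_le[of "int q" "\<bar>f (x [^] q) - f x\<bar>"] by fastforce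
qed

lemma f_pow_odd:
  assumes square: "order G = m\<^sup>2" and "odd t" "coprime t (order G)" "x \<in> carrier G"
  shows "f (x [^] t) = f x"
  using assms(2-)
proof (induction t arbitrary: x rule: prime_divisors_induct)
  case (factor q t)
  then have "f ((x [^] q) [^] t) = f (x [^] q)" by (intro factor.IH) auto
  also have "\<dots> = f x" using factor by (intro f_pow_odd_prime[OF square]) auto
  finally show ?case using factor.prems by (simp add: nat_pow_pow)
qed auto

lemma f_pow:
  assumes square: "order G = m\<^sup>2" and t: "coprime t (order G)" and x: "x \<in> carrier G"
  shows "f (x [^] t) = f x"
proof (cases "odd t")
  case False
  have "x [^] t = x [^] (t + order G)" using x by (simp add: nat_pow_mult[symmetric] pow_order_eq_1)
  moreover have "coprime (t + order G) (order G)" using t by (simp add: coprime_iff_gcd_eq_1)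
  ultimately show ?thesis
    using f_pow_odd[OF square, of "t + order G"] False odd_order x by simp
qed (use assms f_pow_odd in auto)

lemma f_pow_mult:
  assumes square: "order G = m\<^sup>2" and order: "order G = N * M" and cop: "coprime N M"
    and x: "x \<in> carrier G" "x [^] N = \<one>" and y: "y \<in> carrier G" "y [^] M = \<one>" and t: "coprime t N"
  shows "f (x [^] t \<otimes> y) = f (x \<otimes> y)"
proof -
  obtain s where s: "[s = t] (mod N)" "[s = 1] (mod M)"
    using binary_chinese_remainder_nat[OF cop] by blast
  have "coprime s N" using s(1) t by (metis cong_imp_coprime cong_sym)
  moreover have "coprime s M" using s(2) by (metis cong_imp_coprime cong_sym coprime_1_left)
  ultimately have "coprime s (order G)" by (simp add: order)
  then have "f ((x \<otimes> y) [^] s) = f (x \<otimes> y)" using f_pow[OF square] x y by simp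
  moreover have "(x \<otimes> y) [^] s = x [^] t \<otimes> y"
    using pow_eq_of_cong[OF x s(1)] pow_eq_of_cong[OF y s(2)] x y
    by (simp add: pow_mult_distrib m_comm)
  ultimately show ?thesis by simp
qed

lemma conv_pushforward_f:
  assumes P: "subgroup P G" and w: "w \<in> carrier (G Mod P)"
  defines "F \<equiv> pushforward (\<lambda>x. P #> x) f"
  shows "finite_group.conv (G Mod P) F F w
    = int (card P) * ((if w = P then int (order (G Mod P)) else 0) - 1)"
proof -
  interpret H: finite_comm_group "G Mod P" by (rule finite_comm_group_FactGroup[OF P])
  have sub: "P \<subseteq> carrier G" using P subgroup.subset by blast
  obtain a where a: "a \<in> carrier G" "w = P #> a" using w by (auto simp: carrier_FactGroup)
  have "H.conv F F w = pushforward (\<lambda>x. P #> x) (conv f f) w"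
    unfolding F_def
    by (rule conv_pushforward[OF H.finite_group_axioms
          normal.r_coset_hom_Mod[OF subgroup_imp_normal[OF P]] w])
  also have "\<dots> = (\<Sum>x\<in>P. conv f f (x \<otimes> a))" using P a by (simp add: pushforward_r_coset)
  also have "\<dots> = (\<Sum>x\<in>P. (if x = inv a then int (order G) else 0) - 1)"
  proof (rule sum.cong)
    fix x assume "x \<in> P"
    then have x: "x \<in> carrier G" using sub by blast
    have "x \<otimes> a = \<one> \<longleftrightarrow> x = inv a" using x a by (metis inv_equality l_inv)
    then show "conv f f (x \<otimes> a) = (if x = inv a then int (order G) else 0) - 1"
      using x a by (simp add: conv_f_f)
  qed simp
  also have "\<dots> = (if inv a \<in> P then int (order G) else 0) - int (card P)"
    using finite_subset[OF sub] by (simp add: sum_subtractf)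
  also have "inv a \<in> P \<longleftrightarrow> w = P"
    using a P r_coset_eq_subgroup_iff by (metis inv_inv subgroup.m_inv_closed)
  finally show ?thesis
    by (simp add: order_FactGroup[OF P, symmetric] algebra_simps)
qed

lemma odd_coset_sum:
  assumes P: "subgroup P G" "odd (card P)" and y: "y \<in> carrier G - P"
  shows "odd (\<Sum>x\<in>P. f (x \<otimes> y))"
proof -
  have sub: "P \<subseteq> carrier G" using P subgroup.subset by blast
  have "odd (f (x \<otimes> y))" if "x \<in> P" for x
    by (rule odd_f[OF mult_notin_subgroup_neq_one[OF P(1) that y]])
  then have "{x \<in> P. odd (f (x \<otimes> y))} = P" by auto
  then show ?thesis
    using even_sum_iff[OF finite_subset[OF sub finite_carrier], of "\<lambda>x. f (x \<otimes> y)"] P(2) by simp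
qed

lemma abs_coset_sum:
  assumes P: "subgroup P G" and card_P: "card P = n\<^sup>2" and order: "order G = n\<^sup>2 * M"
    and cop: "coprime n M" and y: "y \<in> carrier G - P"
  shows "\<bar>\<Sum>x\<in>P. f (x \<otimes> y)\<bar> = int n"
proof -
  interpret H: finite_comm_group "G Mod P" by (rule finite_comm_group_FactGroup[OF P])
  interpret hom: group_hom G "G Mod P" "\<lambda>x. P #> x"
    by (intro group_hom.intro group_hom_axioms.intro is_group H.is_group
        normal.r_coset_hom_Mod[OF subgroup_imp_normal[OF P]])
  define F where "F = pushforward (\<lambda>x. P #> x) f"
  have n0: "n > 0" using odd_order by (auto simp: order intro: Nat.gr0I)
  have order_H: "order (G Mod P) = M"
    using order_FactGroup[OF P] n0 by (simp add: card_P order)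
  have "\<bar>F (P #> y)\<bar> = int n"
  proof (rule H.abs_eq_of_conv_self)
    show "H.conv F F w
        = (int n)\<^sup>2 * ((if w = \<one>\<^bsub>G Mod P\<^esub> then int (order (G Mod P)) else 0) - 1)"
      if "w \<in> carrier (G Mod P)" for w
      using conv_pushforward_f[OF P that] by (simp add: F_def card_P)
    show "F (inv\<^bsub>G Mod P\<^esub> w) = F w" if "w \<in> carrier (G Mod P)" for w
      unfolding F_def pushforward_def
      by (rule sum.reindex_bij_witness[where i = "\<lambda>x. inv x" and j = "\<lambda>x. inv x"])
         (use that f_inv in \<open>auto simp: hom.hom_inv\<close>)
    show "F w \<noteq> 0" if w: "w \<in> carrier (G Mod P) - {\<one>\<^bsub>G Mod P\<^esub>}" for w
    proof -
      obtain a where a: "a \<in> carrier G" "w = P #> a" using w by (auto simp: carrier_FactGroup)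
      then have "odd (F w)"
        using w odd_coset_sum[OF P, of a] odd_order r_coset_eq_subgroup_iff[OF P]
        by (simp add: F_def pushforward_r_coset[OF P] card_P order)
      then show ?thesis by auto
    qed
    show "P #> y \<noteq> \<one>\<^bsub>G Mod P\<^esub>" using y r_coset_eq_subgroup_iff[OF P] by simp
  qed (use n0 cop order_H y in \<open>auto simp: carrier_FactGroup\<close>)
  then show ?thesis using P y by (simp add: F_def pushforward_r_coset)
qed

end

lemma odd_power2_cong_1:
  fixes p :: int
  assumes "odd p"
  shows "[p\<^sup>2 = 1] (mod 2 * (p - 1))"
proof -
  have "2 * (p - 1) dvd (p + 1) * (p - 1)" using assms by (intro mult_dvd_mono) auto
  then show ?thesis by (simp add: cong_iff_dvd_diff power2_eq_square algebra_simps)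
qed

lemma eq_3_of_abs_power_cong:
  fixes p e d :: int
  assumes p: "p > 1" "odd p" and k: "odd k" and e: "\<bar>e\<bar> = p ^ k" and d: "\<bar>d\<bar> = 1"
    and cong: "[e = d] (mod 2 * (p - 1))"
  shows "p = 3"
proof -
  obtain j where j: "k = 2 * j + 1" using k by (auto elim: oddE)
  have "[(p\<^sup>2) ^ j * p = 1 ^ j * p] (mod 2 * (p - 1))"
    by (intro cong_mult cong_pow odd_power2_cong_1 p(2) cong_refl)
  then have pk: "[p ^ k = p] (mod 2 * (p - 1))" by (simp add: j power_mult mult.commute[of p])
  have "e * d = p ^ k \<or> e * d = - (p ^ k)" using e d by (auto simp: abs_if split: if_splits)
  then have "[e * d = p] (mod 2 * (p - 1)) \<or> [e * d = - p] (mod 2 * (p - 1))"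
    using pk by (auto simp: cong_minus_minus_iff)
  moreover have "[e * d = 1] (mod 2 * (p - 1))"
    using cong_scalar_right[OF cong, of d] d by (auto simp: abs_if split: if_splits)
  ultimately have "[p = 1] (mod 2 * (p - 1)) \<or> [- p = 1] (mod 2 * (p - 1))"
    by (meson cong_sym cong_trans)
  then have "2 * (p - 1) dvd p - 1 \<or> 2 * (p - 1) dvd p + 1"
    using dvd_minus_iff[of "2 * (p - 1)" "p + 1"] by (simp add: cong_iff_dvd_diff)
  then have "2 * (p - 1) \<le> p - 1 \<or> 2 * (p - 1) \<le> p + 1" using p(1) by (auto dest: zdvd_imp_le)
  then show "p = 3" using p by presburger
qed

context paley_function
begin

lemma prime_minus_one_dvd_card_coset_ones:
  assumes square: "order G = m\<^sup>2" and P: "subgroup P G" and card_P: "card P = p ^ j"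
    and order: "order G = p ^ j * M" and p: "prime p" "coprime p M"
    and y: "y \<in> carrier G" "y [^] M = \<one>"
  shows "(p - 1) dvd card {x \<in> P - {\<one>}. f (x \<otimes> y) = 1}"
proof (rule prime_minus_one_dvd_card[OF p(1)])
  let ?A = "{x \<in> P - {\<one>}. f (x \<otimes> y) = 1}"
  show "?A \<subseteq> carrier G - {\<one>}" using subgroup.subset[OF P] by auto
  fix x assume "x \<in> ?A"
  then have x: "x \<in> P" "x \<in> carrier G" "x \<noteq> \<one>" "f (x \<otimes> y) = 1"
    using subgroup.subset[OF P] by auto
  show torsion: "x [^] (p ^ j) = \<one>" using subgroup_pow_card[OF P x(1)] by (simp add: card_P)
  fix t :: nat assume "coprime t p"
  then have t: "coprime t (p ^ j)" by simp
  have "coprime (p ^ j) M" using p(2) by simp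
  then have "f (x [^] t \<otimes> y) = 1"
    using f_pow_mult[OF square order _ x(2) torsion y t] x(4) by simp
  moreover have "x [^] t \<noteq> \<one>" using eq_one_of_coprime_pow[OF x(2) t] x(3) torsion by blast
  moreover have "x [^] t \<in> P"
    using subgroup_int_pow_closed[OF P x(1), of "int t"] by (simp add: int_pow_int)
  ultimately show "x [^] t \<in> ?A" by simp
qed

lemma coset_sum_cong:
  assumes square: "order G = m\<^sup>2" and P: "subgroup P G" and card_P: "card P = p ^ (2 * k)"
    and order: "order G = p ^ (2 * k) * M" and p: "prime p" "odd p" "coprime p M"
    and y: "y \<in> carrier G - P" "y [^] M = \<one>"
  shows "[(\<Sum>x\<in>P. f (x \<otimes> y)) = f y] (mod 2 * (int p - 1))"
proof -
  define A where "A = {x \<in> P - {\<one>}. f (x \<otimes> y) = 1}"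
  have finP: "finite P" by (rule finite_subset[OF subgroup.subset[OF P]]) simp
  have oneP: "\<one> \<in> P" by (rule subgroup.one_closed[OF P])
  have f_eq: "f (x \<otimes> y) = 2 * of_bool (f (x \<otimes> y) = 1) - 1" if "x \<in> P" for x
    using f_sign[OF mult_notin_subgroup_neq_one[OF P that y(1)]] by auto
  have "(\<Sum>x\<in>P. f (x \<otimes> y)) = f y + (\<Sum>x\<in>P - {\<one>}. 2 * of_bool (f (x \<otimes> y) = 1) - 1)"
    using sum.remove[OF finP oneP, of "\<lambda>x. f (x \<otimes> y)"] f_eq y(1) by (auto intro!: sum.cong)
  also have "\<dots> = f y + 2 * int (card A) - (int (card P) - 1)"
    using finP card_Suc_Diff1[OF finP oneP]
    by (simp add: sum_subtractf sum_distrib_left[symmetric] A_def Int_def)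
  finally have sum_diff: "(\<Sum>x\<in>P. f (x \<otimes> y)) - f y = 2 * int (card A) - (int (card P) - 1)"
    by simp
  have "int (p - 1) dvd int (card A)"
    unfolding A_def int_dvd_int_iff
    by (rule prime_minus_one_dvd_card_coset_ones[OF square P card_P order p(1,3) _ y(2)])
       (use y(1) in simp)
  then have "2 * (int p - 1) dvd 2 * int (card A)"
    using prime_gt_0_nat[OF p(1)] by (intro mult_dvd_mono) (simp_all add: of_nat_diff)
  moreover have "2 * (int p - 1) dvd int (card P) - 1"
  proof -
    have "[((int p)\<^sup>2) ^ k = 1 ^ k] (mod 2 * (int p - 1))"
      using p(2) by (intro cong_pow odd_power2_cong_1) simp
    then show ?thesis by (simp add: card_P power_mult cong_iff_dvd_diff)
  qed
  ultimately show ?thesis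
    unfolding cong_iff_dvd_diff sum_diff by (rule dvd_diff)
qed

lemma prime_eq_3:
  assumes square: "order G = m\<^sup>2" and order: "order G = p ^ (2 * k) * M"
    and p: "prime p" "coprime p M" and M: "M > 1" and k: "odd k"
  shows "p = 3"
proof -
  obtain P where P: "subgroup P G" "card P = p ^ (2 * k)"
    using sylow_thm[OF p(1) is_group order] by auto
  obtain y where y: "y \<in> carrier G" "y \<noteq> \<one>" "y [^] M = \<one>"
    using exists_nontrivial_torsion[of M] M order by auto
  have odd_p: "odd p" using odd_order k by (auto simp: order elim: oddE)
  have yP: "y \<in> carrier G - P"
    using subgroup_pow_card[OF P(1), of y] eq_one_of_coprime_pow[of y "p ^ (2 * k)" M] y p(2) P(2)
    by auto
  have "\<bar>\<Sum>x\<in>P. f (x \<otimes> y)\<bar> = int p ^ k"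
    using abs_coset_sum[OF P(1) _ _ _ yP, of "p ^ k" M] P(2) order p(2)
    by (simp add: power_mult[symmetric] mult.commute)
  moreover have "\<bar>f y\<bar> = 1" using f_sign[of y] y by auto
  ultimately have "int p = 3"
    using coset_sum_cong[OF square P order p(1) odd_p p(2) yP y(3)] k odd_p prime_gt_1_nat[OF p(1)]
    by (intro eq_3_of_abs_power_cong) auto
  then show ?thesis by simp
qed

end

section \<open>Paley type partial difference sets\<close>

definition paley_sign :: "('a, 'b) monoid_scheme \<Rightarrow> 'a set \<Rightarrow> 'a \<Rightarrow> int" where
  "paley_sign G D x = (if x = \<one>\<^bsub>G\<^esub> then 0 else if x \<in> D then 1 else - 1)"

lemma regular_subset_inv_mem_iff:
  fixes G (structure)
  assumes "group G" "regular_subset G D" "x \<in> carrier G"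
  shows "inv x \<in> D \<longleftrightarrow> x \<in> D"
proof -
  interpret group G by fact
  show ?thesis using assms by (metis image_eqI inv_inv regular_subset_def)
qed

lemma (in group) card_quotient_pairs:
  assumes D: "D \<subseteq> carrier G" "regular_subset G D" and z: "z \<in> carrier G" "z \<noteq> \<one>"
  shows "card {(g, h). g \<in> D \<and> h \<in> D \<and> g \<noteq> h \<and> g \<otimes> inv h = z} = card {x \<in> D. inv x \<otimes> z \<in> D}"
proof -
  have mem_iff: "inv g \<otimes> z \<in> D \<longleftrightarrow> inv z \<otimes> g \<in> D" if "g \<in> D" for g
    using that z D(1) regular_subset_inv_mem_iff[OF is_group D(2), of "inv z \<otimes> g"]
    by (auto simp: inv_mult_group)
  have quotient_iff: "g \<otimes> inv h = z \<longleftrightarrow> h = inv z \<otimes> g" if "g \<in> D" "h \<in> D" for g h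
  proof -
    have "g \<in> carrier G" "h \<in> carrier G" using that D(1) by auto
    then show ?thesis using z by (metis inv_solve_left inv_solve_right)
  qed
  have shift_neq: "g \<noteq> inv z \<otimes> g" if "g \<in> D" for g
  proof -
    have "g \<in> carrier G" using that D(1) by auto
    then show ?thesis using z by (metis inv_closed inv_eq_1_iff r_cancel_one')
  qed
  have "g \<in> D \<and> h \<in> D \<and> g \<noteq> h \<and> g \<otimes> inv h = z
      \<longleftrightarrow> g \<in> {x \<in> D. inv x \<otimes> z \<in> D} \<and> h = inv z \<otimes> g" for g h
    using shift_neq[of g] by (auto simp: quotient_iff mem_iff cong: conj_cong)
  then have "{(g, h). g \<in> D \<and> h \<in> D \<and> g \<noteq> h \<and> g \<otimes> inv h = z}
      = (\<lambda>x. (x, inv z \<otimes> x)) ` {x \<in> D. inv x \<otimes> z \<in> D}"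
    by (simp only:) auto
  then show ?thesis by (simp add: card_image inj_on_def)
qed

lemma (in finite_group) conv_indicator_self:
  assumes D: "D \<subseteq> carrier G" "regular_subset G D" and z: "z \<in> carrier G"
  shows "conv (\<lambda>x. of_bool (x \<in> D)) (\<lambda>x. of_bool (x \<in> D)) z = of_nat (if z = \<one> then card D
    else card {(g, h). g \<in> D \<and> h \<in> D \<and> g \<noteq> h \<and> g \<otimes> inv h = z})"
proof -
  let ?S = "{x \<in> D. inv x \<otimes> z \<in> D}"
  have "carrier G \<inter> {x. x \<in> D \<and> inv x \<otimes> z \<in> D} = ?S" using D(1) by auto
  then have "conv (\<lambda>x. of_bool (x \<in> D)) (\<lambda>x. of_bool (x \<in> D)) z = of_nat (card ?S)"
    by (simp add: conv_def of_bool_conj[symmetric])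
  moreover have "?S = D" if "z = \<one>"
    using D that regular_subset_inv_mem_iff[OF is_group D(2)] by auto
  ultimately show ?thesis using card_quotient_pairs[OF D z] by auto
qed

context finite_comm_group
begin

lemma conv_paley_sign_left:
  assumes "\<one> \<notin> D" "z \<in> carrier G"
  shows "conv (paley_sign G D) h z
    = 2 * conv (\<lambda>x. of_bool (x \<in> D)) h z - (\<Sum>x\<in>carrier G. h x) + h z"
proof -
  have "conv (paley_sign G D) h z
      = (\<Sum>x\<in>carrier G. 2 * (of_bool (x \<in> D) * h (inv x \<otimes> z)) - h (inv x \<otimes> z)
          + (if x = \<one> then h z else 0))"
    unfolding conv_def using assms by (intro sum.cong) (auto simp: paley_sign_def)
  then show ?thesis
    using assms(2) by (simp only: sum.distrib sum_subtractf sum_reflect conv_def sum_distrib_left) simp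
qed

lemma conv_paley_sign:
  assumes D: "D \<subseteq> carrier G" "\<one> \<notin> D" "2 * card D + 1 = order G" and z: "z \<in> carrier G"
  shows "conv (paley_sign G D) (paley_sign G D) z
    = 4 * conv (\<lambda>x. of_bool (x \<in> D)) (\<lambda>x. of_bool (x \<in> D)) z
      - 2 * int (card D) + 2 * of_bool (z \<in> D) + paley_sign G D z"
proof -
  let ?d = "\<lambda>x. of_bool (x \<in> D) :: int"
  have sum_d: "(\<Sum>x\<in>carrier G. ?d x) = int (card D)" using D(1) by (simp add: Int_absorb1)
  have "paley_sign G D x = 2 * ?d x - 1 + of_bool (x = \<one>)" for x
    using D(2) by (simp add: paley_sign_def)
  then have "(\<Sum>x\<in>carrier G. paley_sign G D x) = 2 * int (card D) - int (order G) + 1"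
    using sum_d
    by (simp add: sum.distrib sum_subtractf sum_distrib_left[symmetric] order_def Int_insert_right)
  then have "(\<Sum>x\<in>carrier G. paley_sign G D x) = 0" using D(3) by linarith
  then have "conv (paley_sign G D) (paley_sign G D) z
      = 2 * conv (paley_sign G D) ?d z + paley_sign G D z"
    using D(2) z by (simp add: conv_paley_sign_left[of D z "paley_sign G D"] conv_commute[of z ?d])
  then show ?thesis
    using D(2) z sum_d by (simp add: conv_paley_sign_left[of D z ?d])
qed

end

lemma paley_function_paley_sign:
  fixes G (structure)
  assumes "paley_type_pds G D" "regular_subset G D"
  shows "paley_function G (paley_sign G D)"
proof -
  obtain v k l m where pds: "partial_difference_set G v k l m D"
    and params: "2 * k + 1 = v" "4 * l + 5 = v" "4 * m + 1 = v"
    using assms by (auto simp: paley_type_pds_def)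
  interpret comm_group G using pds by (simp add: partial_difference_set_def)
  interpret finite_comm_group G
    by unfold_locales (use pds in \<open>simp add: partial_difference_set_def\<close>)
  have D: "D \<subseteq> carrier G" "card D = k" "\<one> \<notin> D" and v: "order G = v"
    using pds assms(2) by (auto simp: partial_difference_set_def regular_subset_def)
  have conv_d: "conv (\<lambda>x. of_bool (x \<in> D)) (\<lambda>x. of_bool (x \<in> D)) z
      = int (if z = \<one> then k else if z \<in> D then l else m)" if "z \<in> carrier G" for z
    using pds that D(2) conv_indicator_self[OF D(1) assms(2) that]
    unfolding partial_difference_set_def by auto
  show ?thesis
  proof unfold_locales
    fix z assume z: "z \<in> carrier G"
    show "conv (paley_sign G D) (paley_sign G D) z = (if z = \<one> then int (order G) else 0) - 1"
      using params D v z by (auto simp: conv_paley_sign conv_d paley_sign_def)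
  qed (use regular_subset_inv_mem_iff[OF is_group assms(2)] in \<open>auto simp: paley_sign_def\<close>)
qed

lemma one_less_prod_nat:
  fixes f :: "'a \<Rightarrow> nat"
  assumes "finite I" "I \<noteq> {}" "\<And>i. i \<in> I \<Longrightarrow> 1 < f i"
  shows "1 < prod f I"
  using assms by (induction rule: finite_ne_induct) (auto intro: one_less_mult)

theorem theorem1p2:
  fixes G :: "('a, 'b) monoid_scheme" and n :: nat and p k :: "nat \<Rightarrow> nat"
  assumes "comm_group G" and "finite (carrier G)"
    and "n \<ge> 2"
    and "\<And>i. i \<in> {1..n} \<Longrightarrow> prime (p i) \<and> odd (p i)"
    and "inj_on p {1..n}"
    and "\<And>i. i \<in> {1..n} \<Longrightarrow> k i > 0"
    and "order G = (\<Prod>i = 1..n. p i ^ (2 * k i))"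
    and "\<exists>D. paley_type_pds G D \<and> regular_subset G D"
  shows "\<forall>i \<in> {1..n}. odd (k i) \<longrightarrow> [p i = 3] (mod 4)"
proof (intro ballI impI)
  fix i assume i: "i \<in> {1..n}" and odd_k: "odd (k i)"
  obtain D where "paley_type_pds G D" "regular_subset G D" using assms(8) by blast
  then interpret paley_function G "paley_sign G D" by (rule paley_function_paley_sign)
  define M where "M = (\<Prod>j\<in>{1..n} - {i}. p j ^ (2 * k j))"
  have order: "order G = p i ^ (2 * k i) * M"
    unfolding assms(7) M_def using i by (intro prod.remove) auto
  have square: "order G = (\<Prod>j = 1..n. p j ^ k j)\<^sup>2"
    unfolding assms(7) by (simp add: prod_power_distrib power_mult[symmetric] mult.commute)
  have "coprime (p i) (p j ^ (2 * k j))" if "j \<in> {1..n} - {i}" for j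
    using that i assms(4)[of i] assms(4)[of j] inj_onD[OF assms(5), of i j]
    by (auto intro: primes_coprime)
  then have cop: "coprime (p i) M" unfolding M_def by (rule prod_coprime_right)
  have "(if i = 1 then 2 else 1) \<in> {1..n} - {i}" using assms(3) by auto
  moreover have "1 < p j ^ (2 * k j)" if "j \<in> {1..n} - {i}" for j
    using that assms(4,6)[of j] by (intro one_less_power prime_gt_1_nat) auto
  ultimately have "M > 1" unfolding M_def by (intro one_less_prod_nat) auto
  then have "p i = 3" using prime_eq_3[OF square order _ cop _ odd_k] assms(4) i by blast
  then show "[p i = 3] (mod 4)" by simp
qed

end
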